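(* Let $d\in\{2,3\}$, $k\ge1$ and $\hat{\mathbf q}\in\hat{\mathbf V}^k(\hat E)$. If $\hat{\mathbf q}(\hat{\mathbf p}_{\boldsymbol i})=0$ for all tensor-product Gauss–Lobatto points $\hat{\mathbf p}_{\boldsymbol i}$, $\boldsymbol i\in\{0,\dots,k\}^d$, then $\hat{\mathbf q}=0$.
   Context: $\hat E=[-1,1]^d$ with coordinates $(\hat x,\hat y)$ or $(\hat x,\hat y,\hat z)$. Let $\{\xi_k(i)\}_{i=0}^k$ be the $k+1$ points of the Gauss–Lobatto quadrature rule on $[-1,1]$ and, for $\boldsymbol i=(\boldsymbol i_1,\dots,\boldsymbol i_d)\in\{0,\dots,k\}^d$, $\hat{\mathbf p}_{\boldsymbol i}=(\xi_k(\boldsymbol i_1),\dots,\xi_k(\boldsymbol i_d))$. $\mathcal Q^m$ denotes polynomials of degree $\le m$ in each variable. The enhanced Raviart–Thomas space is $\hat{\mathbf V}^k(\hat E)=\hat{\mathbf V}^{k-1}_{RT}(\hat E)\oplus\tilde{\mathcal B}^k(\hat E)$, where $\hat{\mathbf V}^m_{RT}(\hat E)=(\mathcal Q^m+\hat x\mathcal Q^m)\times(\mathcal Q^m+\hat y\mathcal Q^m)\times(\mathcal Q^m+\hat z\mathcal Q^m)$ if $d=3$ (third component omitted if $d=2$), and $\tilde{\mathcal B}^k=\sum_{i=1}^d\tilde{\mathcal B}^k_i$, where (a term whose coefficient is zero is understood to be zero) for $d=2$ $$\tilde{\mathcal B}^k_1=\mathrm{span}\{((a_2+1)\hat x^{a_1}\hat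 y^{a_2},\,-a_1\hat x^{a_1-1}\hat y^{a_2+1})^T:\ 0\le a_1,a_2\le k,\ a_2=k\},$$ $$\tilde{\mathcal B}^k_2=\mathrm{span}\{(-b_2\hat x^{b_1+1}\hat y^{b_2-1},\,(b_1+1)\hat x^{b_1}\hat y^{b_2})^T:\ 0\le b_1,b_2\le k,\ b_1=k\},$$ and for $d=3$ $$\tilde{\mathcal B}^k_1=\mathrm{span}\{((a_2+a_3+2)\hat x^{a_1}\hat y^{a_2}\hat z^{a_3},\,-a_1\hat x^{a_1-1}\hat y^{a_2+1}\hat z^{a_3},\,-a_1\hat x^{a_1-1}\hat y^{a_2}\hat z^{a_3+1})^T:\ 0\le a_i\le k,\ a_2=k\text{ or }a_3=k\},$$ $$\tilde{\mathcal B}^k_2=\mathrm{span}\{(-b_2\hat x^{b_1+1}\hat y^{b_2-1}\hat z^{b_3},\,(b_1+b_3+2)\hat x^{b_1}\hat y^{b_2}\hat z^{b_3},\,-b_2\hat x^{b_1}\hat y^{b_2-1}\hat z^{b_3+1})^T:\ 0\le b_i\le k,\ b_1=k\text{ or }b_3=k\},$$ $$\tilde{\mathcal B}^k_3=\mathrm{span}\{(-c_3\hat x^{c_1+1}\hat y^{c_2}\hat z^{c_3-1},\,-c_3\hat x^{c_1}\hat y^{c_2+1}\hat z^{c_3-1},\,(c_1+c_2+2)\hat x^{c_1}\hat y^{c_2}\hat z^{c_3})^T:\ 0\le c_i\le k,\ c_1=k\text{ or }c_2=k\}.$$ *)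

theory Defs
  imports
    "HOL-Analysis.Analysis"
    "HOL-Computational_Algebra.Polynomial"
    "HOL-Library.Function_Algebras"
    "HOL-Library.Set_Algebras"
begin

text \<open>
  Scalar and vector polynomials in \<open>d\<close> variables are represented by the polynomial functions
  on \<open>real ^ 'd\<close>; such a function is zero iff all its coefficients are zero, and also iff it
  vanishes on the cube \<open>[-1,1]\<close>\<open>\<^sup>d\<close>. The pointwise vector space structure on functions makes
  \<^const>\<open>span\<close> and sums \<open>A + B\<close> of subspaces (elementwise sums of sets) available.
\<close>

instantiation "fun" :: (type, real_vector) real_vector
begin

definition scaleR_fun :: "real \<Rightarrow> ('a \<Rightarrow> 'b) \<Rightarrow> 'a \<Rightarrow> 'b"
  where "scaleR_fun c f = (\<lambda>x. c *\<^sub>R f x)"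

instance
  by standard (simp_all add: scaleR_fun_def fun_eq_iff scaleR_add_right scaleR_add_left)

end


subsection \<open>Gauss--Lobatto points\<close>

text \<open>Rodrigues' formula.\<close>

definition legendre_poly :: "nat \<Rightarrow> real poly"
  where "legendre_poly k = smult (1 / (2 ^ k * fact k)) ((pderiv ^^ k) ([:-1, 0, 1:] ^ k))"

text \<open>
  The \<open>k + 1\<close> nodes (for \<open>k \<ge> 1\<close>) of the Gauss--Lobatto quadrature rule on \<open>[-1,1]\<close> are the two
  end points and the \<open>k - 1\<close> zeros of the derivative of the Legendre polynomial of degree \<open>k\<close>.
  They are numbered from \<open>0\<close> to \<open>k\<close> in increasing order.
\<close>

definition gauss_lobatto_nodes :: "nat \<Rightarrow> real set"
  where "gauss_lobatto_nodes k = {-1, 1} \<union> {x. poly (pderiv (legendre_poly k)) x = 0}"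

definition gl_node :: "nat \<Rightarrow> nat \<Rightarrow> real"
  where "gl_node k i = sorted_list_of_set (gauss_lobatto_nodes k) ! i"

definition gl_point :: "nat \<Rightarrow> ('d \<Rightarrow> nat) \<Rightarrow> real ^ 'd"
  where "gl_point k i = (\<chi> j. gl_node k (i j))"


subsection \<open>The enhanced Raviart--Thomas spaces\<close>

definition Q_space :: "nat \<Rightarrow> (real ^ 'd \<Rightarrow> real) set"
  where "Q_space m = span {\<lambda>x. \<Prod>j\<in>UNIV. x $ j ^ a j | a :: 'd \<Rightarrow> nat. \<forall>j. a j \<le> m}"

definition RT_space :: "nat \<Rightarrow> (real ^ 'd \<Rightarrow> real ^ 'd) set"
  where "RT_space m =
    {q. \<forall>j. (\<lambda>x. q x $ j) \<in> Q_space m + {\<lambda>x. x $ j * g x | g. g \<in> Q_space m}}"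

text \<open>
  Natural number subtraction below truncates only in exponents \<open>n - 1\<close> with \<open>n = 0\<close>; the term
  then has the coefficient \<open>- real n = 0\<close>.
\<close>

definition bubble2_1 :: "nat \<Rightarrow> (real ^ 2 \<Rightarrow> real ^ 2) set"
  where "bubble2_1 k = span {\<lambda>x. vector
      [real (a2 + 1) * x$1 ^ a1 * x$2 ^ a2,
       - real a1 * x$1 ^ (a1 - 1) * x$2 ^ (a2 + 1)]
    | a1 a2. a1 \<le> k \<and> a2 \<le> k \<and> a2 = k}"

definition bubble2_2 :: "nat \<Rightarrow> (real ^ 2 \<Rightarrow> real ^ 2) set"
  where "bubble2_2 k = span {\<lambda>x. vector
      [- real b2 * x$1 ^ (b1 + 1) * x$2 ^ (b2 - 1),
       real (b1 + 1) * x$1 ^ b1 * x$2 ^ b2]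
    | b1 b2. b1 \<le> k \<and> b2 \<le> k \<and> b1 = k}"

definition bubble3_1 :: "nat \<Rightarrow> (real ^ 3 \<Rightarrow> real ^ 3) set"
  where "bubble3_1 k = span {\<lambda>x. vector
      [real (a2 + a3 + 2) * x$1 ^ a1 * x$2 ^ a2 * x$3 ^ a3,
       - real a1 * x$1 ^ (a1 - 1) * x$2 ^ (a2 + 1) * x$3 ^ a3,
       - real a1 * x$1 ^ (a1 - 1) * x$2 ^ a2 * x$3 ^ (a3 + 1)]
    | a1 a2 a3. a1 \<le> k \<and> a2 \<le> k \<and> a3 \<le> k \<and> (a2 = k \<or> a3 = k)}"

definition bubble3_2 :: "nat \<Rightarrow> (real ^ 3 \<Rightarrow> real ^ 3) set"
  where "bubble3_2 k = span {\<lambda>x. vector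
      [- real b2 * x$1 ^ (b1 + 1) * x$2 ^ (b2 - 1) * x$3 ^ b3,
       real (b1 + b3 + 2) * x$1 ^ b1 * x$2 ^ b2 * x$3 ^ b3,
       - real b2 * x$1 ^ b1 * x$2 ^ (b2 - 1) * x$3 ^ (b3 + 1)]
    | b1 b2 b3. b1 \<le> k \<and> b2 \<le> k \<and> b3 \<le> k \<and> (b1 = k \<or> b3 = k)}"

definition bubble3_3 :: "nat \<Rightarrow> (real ^ 3 \<Rightarrow> real ^ 3) set"
  where "bubble3_3 k = span {\<lambda>x. vector
      [- real c3 * x$1 ^ (c1 + 1) * x$2 ^ c2 * x$3 ^ (c3 - 1),
       - real c3 * x$1 ^ c1 * x$2 ^ (c2 + 1) * x$3 ^ (c3 - 1),
       real (c1 + c2 + 2) * x$1 ^ c1 * x$2 ^ c2 * x$3 ^ c3]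
    | c1 c2 c3. c1 \<le> k \<and> c2 \<le> k \<and> c3 \<le> k \<and> (c1 = k \<or> c2 = k)}"

text \<open>For \<open>k \<ge> 1\<close>; directness of the sum of the two summands plays no role in the definition.\<close>

definition enhanced_RT2 :: "nat \<Rightarrow> (real ^ 2 \<Rightarrow> real ^ 2) set"
  where "enhanced_RT2 k = RT_space (k - 1) + (bubble2_1 k + bubble2_2 k)"

definition enhanced_RT3 :: "nat \<Rightarrow> (real ^ 3 \<Rightarrow> real ^ 3) set"
  where "enhanced_RT3 k = RT_space (k - 1) + (bubble3_1 k + bubble3_2 k + bubble3_3 k)"

end

theory Submission
  imports Defs
begin

text \<open>
  The proof works with coefficients and is uniform in the dimension \<open>d\<close>. Only one property of the
  Gauss--Lobatto nodes enters: there are \<open>k + 1\<close> different ones (\<open>gl_node_range\<close>).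

  The \<open>i\<close>-th component of an enhanced Raviart--Thomas function has degree at most \<open>k + 1\<close> in
  \<open>x\<^sub>i\<close> and at most \<open>k\<close> in each other variable. On a hyperplane \<open>x\<^sub>i = t\<close> through a node \<open>t\<close> it is
  therefore determined by its values at the grid points, so it vanishes there. Hence each polynomial
  in \<open>x\<^sub>i\<close> that multiplies a monomial in the other variables vanishes at all \<open>k + 1\<close> nodes; as its
  degree is at most \<open>k + 1\<close>, it is zero as soon as its coefficient of \<open>x\<^sub>i\<close>\<open>\<^sup>k\<^sup>+\<^sup>1\<close> is zero
  (\<open>grid_line_coeffs_zero\<close>). What remains is to show that these leading coefficients vanish.

  Leading coefficients come from the bubbles only. Let \<open>D\<^sub>j b\<close> be the coefficient with which the bubble
  of direction \<open>j\<close> and exponent \<open>b + e\<^sub>j\<close> occurs. The bubbles then contribute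
    \<open>\<Sum>j\<noteq>i. (b\<^sub>j + 1) (D\<^sub>i b - D\<^sub>j b)\<close>
  to the coefficient of the monomial with exponent \<open>b + e\<^sub>i\<close> in the \<open>i\<close>-th component: for fixed \<open>b\<close> this is
  the value at \<open>i\<close> of a weighted Laplacian of the complete graph on the directions
  (\<open>bubble_coeff_shift\<close>). Let \<open>K\<close> be the set of the
  directions \<open>l\<close> with \<open>b\<^sub>l = k\<close>. All \<open>D\<^sub>j b\<close> vanish if \<open>K\<close> is empty, and \<open>D\<^sub>j b = 0\<close> for \<open>j \<in> K\<close>, because of
  the range of the bubble exponents. If \<open>K\<close> is nonempty and the Laplacian vanishes at
  the directions outside \<open>K\<close>, then \<open>D b = 0\<close> by the maximum principle, \<open>K\<close> acting as a boundary with
  zero data (\<open>diagonally_dominant_zero\<close>). For \<open>i \<notin> K\<close>, the Laplacian at \<open>b\<close> does vanish if the leading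
  coefficient on the line through \<open>b\<close> in the direction \<open>i\<close> is zero; that coefficient is the Laplacian at
  \<open>b\<close> with its \<open>i\<close>-th entry replaced by \<open>k\<close>, for which the set corresponding to \<open>K\<close> is larger. So
  induction over the size of \<open>K\<close>, from large to small, gives \<open>D = 0\<close> (\<open>enhanced_RT_unisolvent\<close>).
  Then all leading coefficients are zero, and with them the function.
\<close>

section \<open>The Gauss--Lobatto nodes are distinct\<close>

text \<open>
  Between each two neighbouring roots of \<open>p\<close> there is a root of its derivative; adding the elements of
  \<open>X\<close> in increasing order keeps the new root apart from the earlier ones.
\<close>

lemma rolle_root_set:
  fixes p :: "real poly"
  assumes "finite X" "X \<noteq> {}" "\<forall>x\<in>X. poly p x = 0"
  shows "\<exists>Y. finite Y \<and> card X = Suc (card Y) \<and> Y \<subseteq> {Min X<..<Max X} \<and>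
           (\<forall>y\<in>Y. poly (pderiv p) y = 0)"
  using assms
proof (induction X rule: finite_linorder_max_induct)
  case empty
  then show ?case by simp
next
  case (insert M X)
  show ?case
  proof (cases "X = {}")
    case True
    then show ?thesis by (intro exI[of _ "{}"]) auto
  next
    case False
    then obtain Y where Y: "finite Y" "card X = Suc (card Y)" "Y \<subseteq> {Min X<..<Max X}"
        "\<forall>y\<in>Y. poly (pderiv p) y = 0"
      using insert by auto
    have max: "Max X \<in> X" "Max X < M"
      using insert False by auto
    have "\<exists>y>Max X. y < M \<and> DERIV (poly p) y :> 0"
      using insert.prems max
      by (intro Rolle) (auto intro!: continuous_intros simp: real_differentiable_def intro: poly_DERIV)
    then obtain y where y: "Max X < y" "y < M" "poly (pderiv p) y = 0"
      by (metis DERIV_unique poly_DERIV)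
    have M: "Max (insert M X) = M" "Min (insert M X) = Min X"
      using insert.hyps(1) False max Min_le[OF insert.hyps(1) max(1)] by simp_all
    have "M \<notin> X" using max(2) insert.hyps(1) by (meson Max_ge leD)
    moreover have "y \<notin> Y" using Y(3) y(1) by auto
    ultimately have "card (insert M X) = Suc (card (insert y Y))"
      using Y(1,2) insert.hyps(1) by simp
    moreover have "insert y Y \<subseteq> {Min X<..<M}"
    proof -
      have "Min X \<le> Max X" using insert.hyps False by simp
      then show ?thesis using Y(3) y(1,2) max(2) by fastforce
    qed
    moreover have "\<forall>y\<in>insert y Y. poly (pderiv p) y = 0" using Y(4) y(3) by blast
    ultimately show ?thesis
      unfolding M using Y(1) by (metis finite_insert)
  qed
qed

lemma power_dvd_pderiv:
  fixes u p :: "real poly"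
  assumes "u ^ Suc n dvd p"
  shows "u ^ n dvd pderiv p"
proof -
  obtain w where "p = u ^ Suc n * w" using assms by (elim dvdE)
  then have "pderiv p = u ^ n * (u * pderiv w + smult (1 + real n) (pderiv u * w))"
    by (simp add: pderiv_mult pderiv_power_Suc algebra_simps del: power_Suc)
       (simp add: algebra_simps)
  then show ?thesis by simp
qed

lemma power_dvd_higher_pderiv:
  "j \<le> k \<Longrightarrow> (u :: real poly) ^ (k - j) dvd (pderiv ^^ j) (u ^ k)"
proof (induction j)
  case (Suc j)
  then have eq: "k - j = Suc (k - Suc j)" by simp
  have "u ^ (k - j) dvd (pderiv ^^ j) (u ^ k)" using Suc by simp
  then show ?case unfolding eq funpow.simps o_apply by (rule power_dvd_pderiv)
qed simp

text \<open>
  As long as \<open>j < k\<close>, the points \<open>-1\<close> and \<open>1\<close> are still roots of the \<open>j\<close>-th derivative. They join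
  the \<open>j\<close> roots inside, and Rolle's theorem turns \<open>j + 2\<close> roots into \<open>j + 1\<close> interior roots of the
  next derivative.
\<close>

lemma higher_pderiv_roots:
  assumes "j \<le> k"
  shows "\<exists>Y. finite Y \<and> card Y = j \<and> Y \<subseteq> {-1<..<1} \<and>
           (\<forall>y\<in>Y. poly ((pderiv ^^ j) ([:-1, 0, 1:] ^ k)) y = (0::real))"
  using assms
proof (induction j)
  case 0
  then show ?case by (intro exI[of _ "{}"]) auto
next
  case (Suc j)
  let ?p = "(pderiv ^^ j) ([:-1, 0, 1:] ^ k) :: real poly"
  obtain Y where Y: "finite Y" "card Y = j" "Y \<subseteq> {-1<..<1}" "\<forall>y\<in>Y. poly ?p y = 0"
    using Suc by auto
  have "[:-1, 0, 1:] ^ (k - j) dvd ?p"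
    using Suc by (intro power_dvd_higher_pderiv) simp
  then obtain w where w: "?p = [:-1, 0, 1:] ^ (k - j) * w" by (elim dvdE)
  have "k - j \<noteq> 0" using Suc.prems by simp
  then have ends: "poly ?p (-1) = 0" "poly ?p 1 = 0"
    unfolding w by simp_all
  let ?X = "insert (-1) (insert 1 Y)"
  have "\<forall>x\<in>?X. -1 \<le> x \<and> x \<le> 1"
    using Y(3) by force
  then have minmax: "Min ?X \<ge> -1" "Max ?X \<le> 1"
    using Y(1) by (intro Min.boundedI Max.boundedI; blast)+
  have "-1 \<notin> Y" "1 \<notin> Y"
    using Y(3) by auto
  then have card: "card ?X = Suc (Suc j)"
    using Y(1,2) by simp
  have "\<exists>Z. finite Z \<and> card ?X = Suc (card Z) \<and> Z \<subseteq> {Min ?X<..<Max ?X} \<and>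
      (\<forall>y\<in>Z. poly (pderiv ?p) y = 0)"
    using Y(1,4) ends by (intro rolle_root_set) blast+
  then obtain Z where Z: "finite Z" "card ?X = Suc (card Z)" "Z \<subseteq> {Min ?X<..<Max ?X}"
      "\<forall>y\<in>Z. poly (pderiv ?p) y = 0"
    by blast
  have "{Min ?X<..<Max ?X} \<subseteq> {-1<..<1}"
    using minmax by (simp only: greaterThanLessThan_subseteq_greaterThanLessThan) simp
  with Z(3) have "Z \<subseteq> {-1<..<1}" by (rule order_trans)
  moreover have "card Z = Suc j" using Z(2) card by linarith
  ultimately show ?case
    using Z(1,4) unfolding funpow.simps o_apply by blast
qed

lemma degree_higher_pderiv: "degree ((pderiv ^^ j) (p :: real poly)) = degree p - j"
  by (induction j) (auto simp: degree_pderiv)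

text \<open>
  By Rodrigues' formula the Legendre polynomial of degree \<open>k\<close> has \<open>k\<close> different roots inside
  \<open>(-1, 1)\<close>, so its derivative has \<open>k - 1\<close> of them; the two end points complete the nodes.
\<close>

lemma gl_node_range:
  assumes "k \<ge> 1"
  shows "card (gl_node k ` {..k}) = Suc k"
proof -
  let ?G = "gauss_lobatto_nodes k"
  let ?p = "(pderiv ^^ k) ([:-1, 0, 1:] ^ k) :: real poly"
  have deg: "degree ?p = k"
    by (simp add: degree_higher_pderiv degree_power_eq)
  then have "pderiv ?p \<noteq> 0"
    using assms by (simp add: pderiv_eq_0_iff)
  then have fin: "finite ?G"
    by (simp add: gauss_lobatto_nodes_def legendre_poly_def pderiv_smult poly_roots_finite)
  obtain Y where Y: "finite Y" "card Y = k" "Y \<subseteq> {-1<..<1}" "\<forall>y\<in>Y. poly ?p y = 0"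
    using higher_pderiv_roots[of k k] by auto
  then have ne: "Y \<noteq> {}" using assms by auto
  obtain Z where Z: "finite Z" "k = Suc (card Z)" "Z \<subseteq> {Min Y<..<Max Y}"
      "\<forall>y\<in>Z. poly (pderiv ?p) y = 0"
    using rolle_root_set[OF Y(1) ne Y(4)] Y(2) by auto
  have "Min Y \<in> Y" "Max Y \<in> Y" using Y ne by auto
  then have "-1 \<notin> Z" "1 \<notin> Z" using Y(3) Z(3) by force+
  then have "card (insert (-1) (insert 1 Z)) = Suc k"
    using Z(1,2) by simp
  moreover have "insert (-1) (insert 1 Z) \<subseteq> ?G"
    using Z by (auto simp: gauss_lobatto_nodes_def legendre_poly_def pderiv_smult)
  ultimately have "Suc k \<le> card ?G"
    using card_mono[OF fin] by metis
  then have "inj_on (gl_node k) {..k}"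
    using fin by (auto simp: inj_on_def gl_node_def nth_eq_iff_index_eq)
  then show ?thesis by (simp add: card_image)
qed


section \<open>Polynomials on tensor product grids\<close>

lemma polyfun_coeff_zero:
  fixes d :: "nat \<Rightarrow> real"
  assumes "N < card S" "\<And>t. t \<in> S \<Longrightarrow> (\<Sum>n\<le>N. d n * t ^ n) = 0" "n \<le> N"
  shows "d n = 0"
proof (rule ccontr)
  assume "d n \<noteq> 0"
  then have "\<exists>n\<le>N. d n \<noteq> 0" using assms(3) by auto
  from polyfun_rootbound[OF this]
  have "finite {t. (\<Sum>n\<le>N. d n * t ^ n) = 0}" "card {t. (\<Sum>n\<le>N. d n * t ^ n) = 0} \<le> N"
    by auto
  moreover have "S \<subseteq> {t. (\<Sum>n\<le>N. d n * t ^ n) = 0}" using assms by auto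
  ultimately show False using assms(1) by (meson card_mono leD le_trans)
qed

lemma sum_PiE_insert:
  fixes f :: "_ \<Rightarrow> real"
  assumes "i \<notin> J"
  shows "(\<Sum>a\<in>PiE (insert i J) T. f a) = (\<Sum>n\<in>T i. \<Sum>b\<in>PiE J T. f (b(i := n)))"
  unfolding PiE_insert_eq sum.cartesian_product
  by (subst sum.reindex[OF inj_combinator[OF assms]]) (simp add: case_prod_unfold comp_def)

text \<open>
  One variable at a time: for fixed values of the other variables the sum is a polynomial in \<open>x\<^sub>i\<close> with
  more roots than its degree, so each of its coefficients, a polynomial in the other variables,
  vanishes on the smaller grid.
\<close>

lemma tensor_grid_unisolvent:
  fixes c :: "('i \<Rightarrow> nat) \<Rightarrow> real"
  assumes "finite J" "\<forall>j\<in>J. N j < card S"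
    and "\<And>x. \<forall>j\<in>J. x j \<in> S \<Longrightarrow> (\<Sum>a\<in>PiE J (\<lambda>j. {..N j}). c a * (\<Prod>j\<in>J. x j ^ a j)) = 0"
    and "a \<in> PiE J (\<lambda>j. {..N j})"
  shows "c a = 0"
  using assms
proof (induction J arbitrary: c a rule: finite_induct)
  case empty
  then show ?case by simp
next
  case (insert i J)
  let ?P = "PiE J (\<lambda>j. {..N j})"
  have "(\<Sum>b\<in>?P. c (b(i := n)) * (\<Prod>j\<in>J. x j ^ b j)) = 0"
    if x: "\<forall>j\<in>J. x j \<in> S" and n: "n \<le> N i" for x n
  proof (rule polyfun_coeff_zero[OF _ _ n])
    fix t assume "t \<in> S"
    have *: "(\<Prod>j\<in>insert i J. (x(i := t)) j ^ (b(i := n)) j) = t ^ n * (\<Prod>j\<in>J. x j ^ b j)" for b n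
    proof -
      have "(\<Prod>j\<in>J. (x(i := t)) j ^ (b(i := n)) j) = (\<Prod>j\<in>J. x j ^ b j)"
        using insert.hyps by (intro prod.cong) auto
      then show ?thesis using insert.hyps by simp
    qed
    have "0 = (\<Sum>a\<in>PiE (insert i J) (\<lambda>j. {..N j}). c a * (\<Prod>j\<in>insert i J. (x(i := t)) j ^ a j))"
      using x \<open>t \<in> S\<close> by (intro insert.prems(2)[symmetric]) auto
    also have "\<dots> = (\<Sum>n\<le>N i. (\<Sum>b\<in>?P. c (b(i := n)) * (\<Prod>j\<in>J. x j ^ b j)) * t ^ n)"
      unfolding sum_PiE_insert[OF insert.hyps(2)] * by (simp add: sum_distrib_left mult_ac)
    finally show "(\<Sum>n\<le>N i. (\<Sum>b\<in>?P. c (b(i := n)) * (\<Prod>j\<in>J. x j ^ b j)) * t ^ n) = 0" ..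
  qed (use insert.prems in auto)
  then have *: "c (b(i := n)) = 0" if "b \<in> ?P" "n \<le> N i" for b n
    using insert.IH[of "\<lambda>b. c (b(i := n))" b] insert.prems(1) that by auto
  from insert.prems(3) show ?case
    unfolding PiE_insert_eq using * by auto
qed

definition monomial :: "('d \<Rightarrow> nat) \<Rightarrow> real ^ 'd \<Rightarrow> real"
  where "monomial a x = (\<Prod>j\<in>UNIV. x $ j ^ a j)"

definition exponent_box :: "nat \<Rightarrow> ('d \<Rightarrow> nat) set"
  where "exponent_box N = {a. \<forall>j. a j \<le> N}"

text \<open>
  All coefficient functions below are read relative to one common box of exponents, which makes this
  evaluation map linear in \<open>c\<close> without conditions on supports.
\<close>

definition polynomial :: "nat \<Rightarrow> (('d \<Rightarrow> nat) \<Rightarrow> real) \<Rightarrow> real ^ 'd \<Rightarrow> real"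
  where "polynomial N c x = (\<Sum>a\<in>exponent_box N. c a * monomial a x)"

lemma finite_exponent_box [simp]: "finite (exponent_box N :: ('d::finite \<Rightarrow> nat) set)"
proof -
  have "exponent_box N = PiE (UNIV :: 'd set) (\<lambda>_. {..N})"
    by (auto simp: exponent_box_def PiE_iff)
  then show ?thesis by (simp add: finite_PiE)
qed

lemma polynomial_zero: "polynomial N (\<lambda>a. 0) x = 0"
  by (simp add: polynomial_def)

lemma polynomial_add: "polynomial N (\<lambda>a. c a + d a) x = polynomial N c x + polynomial N d x"
  by (simp add: polynomial_def algebra_simps sum.distrib)

lemma polynomial_scale: "polynomial N (\<lambda>a. r * c a) x = r * polynomial N c x"
  by (simp add: polynomial_def sum_distrib_left mult_ac)

lemma polynomial_single:
  fixes m :: "'d::finite \<Rightarrow> nat"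
  assumes "m \<in> exponent_box N"
  shows "polynomial N (\<lambda>a. if a = m then r else 0) x = r * monomial m x"
  using assms by (simp add: polynomial_def if_distrib[of "\<lambda>u. u * _"] cong: if_cong)

text \<open>
  The grid has just enough points to determine a polynomial of degree \<open>k\<close> in each variable. One more
  degree in the single direction \<open>i\<close> is harmless: along a line of exponents in that direction, the only
  polynomials left undetermined are the multiples of the one with the nodes as its roots, and these
  are recognised by their leading coefficient.
\<close>

lemma grid_line_coeffs_zero:
  fixes c :: "('d::finite \<Rightarrow> nat) \<Rightarrow> real"
  assumes card: "card S = Suc k"
    and supp: "\<And>a. c a \<noteq> 0 \<Longrightarrow> a i \<le> Suc k \<and> (\<forall>j. j \<noteq> i \<longrightarrow> a j \<le> k)"
    and grid: "\<And>x. \<forall>j. x $ j \<in> S \<Longrightarrow> polynomial (Suc k) c x = 0"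
    and lead: "c (a(i := Suc k)) = 0"
  shows "c (a(i := n)) = 0"
proof (cases "n \<le> k \<and> (\<forall>j. j \<noteq> i \<longrightarrow> a j \<le> k)")
  case False
  then show ?thesis
    using supp[of "a(i := n)"] lead by (cases "n = Suc k"; cases "c (a(i := n)) = 0") auto
next
  case True
  let ?J = "- {i} :: 'd set"
  let ?T = "\<lambda>j. {..if j = i then Suc k else k}"
  have U: "insert i ?J = UNIV" by auto
  \<comment> \<open>On the hyperplane where the \<open>i\<close>-th variable is \<open>t\<close>, the remaining variables have degree at most
    \<open>k\<close>, so the grid in them forces every coefficient to vanish.\<close>
  have line: "(\<Sum>n\<le>Suc k. c (b(i := n)) * t ^ n) = 0"
    if t: "t \<in> S" and b: "b \<in> PiE ?J (\<lambda>_. {..k})" for t b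
  proof (rule tensor_grid_unisolvent[OF _ _ _ b, of S "\<lambda>b. \<Sum>n\<le>Suc k. c (b(i := n)) * t ^ n"])
    fix x assume x: "\<forall>j\<in>?J. x j \<in> S"
    let ?x = "\<chi> j. if j = i then t else x j"
    have mon: "monomial (b(i := n)) ?x = t ^ n * (\<Prod>j\<in>?J. x j ^ b j)" for b n
    proof -
      have "(\<Prod>j\<in>?J. ?x $ j ^ (b(i := n)) j) = (\<Prod>j\<in>?J. x j ^ b j)"
        by (intro prod.cong) auto
      then show ?thesis
        unfolding monomial_def by (subst U[symmetric], subst prod.insert) auto
    qed
    have "0 = polynomial (Suc k) c ?x"
      using x t by (intro grid[symmetric]) auto
    also have "\<dots> = (\<Sum>a\<in>PiE UNIV ?T. c a * monomial a ?x)"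
      unfolding polynomial_def
    proof (rule sum.mono_neutral_right)
      show "PiE UNIV ?T \<subseteq> exponent_box (Suc k)"
        by (auto simp: exponent_box_def PiE_iff split: if_splits) (metis le_SucI)
      show "\<forall>a\<in>exponent_box (Suc k) - PiE UNIV ?T. c a * monomial a ?x = 0"
        using supp by (fastforce simp: PiE_iff)
    qed simp
    also have "\<dots> = (\<Sum>n\<le>Suc k. \<Sum>b\<in>PiE ?J ?T. c (b(i := n)) * monomial (b(i := n)) ?x)"
      by (subst U[symmetric], subst sum_PiE_insert) auto
    also have "\<dots> = (\<Sum>b\<in>PiE ?J ?T. (\<Sum>n\<le>Suc k. c (b(i := n)) * t ^ n) * (\<Prod>j\<in>?J. x j ^ b j))"
      unfolding mon by (subst sum.swap) (simp only: sum_distrib_right mult.assoc)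
    also have "PiE ?J ?T = PiE ?J (\<lambda>_. {..k})"
      by (intro PiE_cong) auto
    finally show "(\<Sum>b\<in>PiE ?J (\<lambda>_. {..k}).
        (\<Sum>n\<le>Suc k. c (b(i := n)) * t ^ n) * (\<Prod>j\<in>?J. x j ^ b j)) = 0" ..
  qed (use card in auto)
  \<comment> \<open>Elements of the function space \<open>PiE\<close> are \<open>undefined\<close> at \<open>i\<close>; the update hides that value.\<close>
  let ?b = "restrict a ?J"
  have upd: "?b(i := n) = a(i := n)" for n by auto
  have "?b \<in> PiE ?J (\<lambda>_. {..k})" using True by auto
  from line[OF _ this] have "(\<Sum>n\<le>k. c (a(i := n)) * t ^ n) = 0" if "t \<in> S" for t
    using that lead unfolding upd by simp
  then show ?thesis
    using polyfun_coeff_zero[of k S "\<lambda>n. c (a(i := n))" n] card True by simp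
qed


section \<open>Coefficients of the enhanced Raviart--Thomas functions\<close>

text \<open>
  For \<open>d = 2\<close> and \<open>d = 3\<close> these are the generators of the spaces \<open>bubble2_i\<close> and \<open>bubble3_i\<close>: their
  factors \<open>a2 + 1\<close> and \<open>a2 + a3 + 2\<close> are the sums of \<open>a l + 1\<close> over the directions \<open>l\<close> other
  than \<open>i\<close>.
\<close>

definition bubble :: "'d::finite \<Rightarrow> ('d \<Rightarrow> nat) \<Rightarrow> real ^ 'd \<Rightarrow> real ^ 'd"
  where "bubble i a x = (\<chi> j. if j = i then (\<Sum>l\<in>-{i}. real (a l) + 1) * monomial a x
           else - real (a i) * monomial (a(i := a i - 1, j := Suc (a j))) x)"

definition bubble_index :: "nat \<Rightarrow> 'd \<Rightarrow> ('d \<Rightarrow> nat) set"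
  where "bubble_index k i = {a. (\<forall>j. a j \<le> k) \<and> (\<exists>j. j \<noteq> i \<and> a j = k)}"

definition bubble_space :: "nat \<Rightarrow> (real ^ 'd \<Rightarrow> real ^ 'd::finite) set"
  where "bubble_space k = span {bubble i a | i a. a \<in> bubble_index k i}"

text \<open>
  The coefficients of the \<open>i\<close>-th component of the combination of the bubbles \<open>bubble j a\<close> with
  weights \<open>A j a\<close>. A bubble of another direction \<open>j\<close> contributes to the exponent \<open>a\<close> if its own
  exponent is \<open>a - e\<^sub>i + e\<^sub>j\<close>, which requires \<open>a i > 0\<close>; its factor is then minus the \<open>j\<close>-th
  entry \<open>a j + 1\<close> of that exponent.
\<close>

definition bubble_coeff :: "('d::finite \<Rightarrow> ('d \<Rightarrow> nat) \<Rightarrow> real) \<Rightarrow> 'd \<Rightarrow> ('d \<Rightarrow> nat) \<Rightarrow> real"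
  where "bubble_coeff A i a = (\<Sum>j\<in>-{i}. (real (a j) + 1) *
           (A i a - (if a i = 0 then 0 else A j (a(i := a i - 1, j := Suc (a j))))))"

lemma bubble_coeff_zero: "bubble_coeff (\<lambda>i a. 0) i = (\<lambda>a. 0)"
  unfolding bubble_coeff_def by (intro ext sum.neutral) auto

lemma bubble_coeff_add:
  "bubble_coeff (\<lambda>i a. A i a + B i a) i = (\<lambda>a. bubble_coeff A i a + bubble_coeff B i a)"
  unfolding bubble_coeff_def sum.distrib[symmetric] by (intro ext sum.cong) (auto simp: algebra_simps)

lemma bubble_coeff_scale:
  "bubble_coeff (\<lambda>i a. r * A i a) i = (\<lambda>a. r * bubble_coeff A i a)"
  unfolding bubble_coeff_def sum_distrib_left by (intro ext sum.cong) (auto simp: algebra_simps)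

lemma bubble_coeff_single:
  fixes a :: "'d::finite \<Rightarrow> nat"
  shows "bubble_coeff (\<lambda>j b. if j = i \<and> b = a then 1 else 0) l =
     (if l = i then (\<lambda>b. if b = a then \<Sum>j\<in>-{i}. real (a j) + 1 else 0)
      else (\<lambda>b. if b = a(i := a i - 1, l := Suc (a l)) then - real (a i) else 0))"
proof
  fix b
  show "bubble_coeff (\<lambda>j b. if j = i \<and> b = a then 1 else 0) l b =
     (if l = i then (\<lambda>b. if b = a then \<Sum>j\<in>-{i}. real (a j) + 1 else 0)
      else (\<lambda>b. if b = a(i := a i - 1, l := Suc (a l)) then - real (a i) else 0)) b"
  proof (cases "l = i")
    case True
    have "bubble_coeff (\<lambda>j b. if j = i \<and> b = a then 1 else 0) i b =
        (\<Sum>j\<in>-{i}. if b = a then real (a j) + 1 else 0)"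
      unfolding bubble_coeff_def by (intro sum.cong) auto
    then show ?thesis using True by simp
  next
    case False
    have shift: "b l \<noteq> 0 \<and> b(l := b l - 1, i := Suc (b i)) = a \<longleftrightarrow>
        a i \<noteq> 0 \<and> b = a(i := a i - 1, l := Suc (a l))"
    proof
      assume "b l \<noteq> 0 \<and> b(l := b l - 1, i := Suc (b i)) = a"
      then have "b l \<noteq> 0" and a: "a = b(l := b l - 1, i := Suc (b i))" by auto
      then show "a i \<noteq> 0 \<and> b = a(i := a i - 1, l := Suc (a l))"
        unfolding a using False by (simp add: fun_eq_iff)
    next
      assume "a i \<noteq> 0 \<and> b = a(i := a i - 1, l := Suc (a l))"
      then have "a i \<noteq> 0" and b: "b = a(i := a i - 1, l := Suc (a l))" by auto
      then show "b l \<noteq> 0 \<and> b(l := b l - 1, i := Suc (b i)) = a"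
        unfolding b using False by (simp add: fun_eq_iff)
    qed
    have "bubble_coeff (\<lambda>j b. if j = i \<and> b = a then 1 else 0) l b =
        (\<Sum>j\<in>-{l}. if j = i then
           (if b l \<noteq> 0 \<and> b(l := b l - 1, i := Suc (b i)) = a then - (real (b i) + 1) else 0) else 0)"
      using False unfolding bubble_coeff_def by (intro sum.cong) auto
    also have "\<dots> = (if b l \<noteq> 0 \<and> b(l := b l - 1, i := Suc (b i)) = a
        then - (real (b i) + 1) else 0)"
      using False by simp
    also have "\<dots> = (if b = a(i := a i - 1, l := Suc (a l)) then - real (a i) else 0)"
      unfolding shift using False by (auto simp: of_nat_diff)
    finally show ?thesis using False by simp
  qed
qed

lemma bubble_space_coeffs:
  fixes q :: "real ^ 'd \<Rightarrow> real ^ 'd::finite"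
  assumes "q \<in> bubble_space k"
  obtains A where "\<And>j a. a \<notin> bubble_index k j \<Longrightarrow> A j a = 0"
    and "\<And>x j. q x $ j = polynomial (Suc k) (bubble_coeff A j) x"
proof -
  let ?T = "{q :: real ^ 'd \<Rightarrow> real ^ 'd. \<exists>A. (\<forall>j a. a \<notin> bubble_index k j \<longrightarrow> A j a = 0) \<and>
                    (\<forall>x j. q x $ j = polynomial (Suc k) (bubble_coeff A j) x)}"
  have "bubble_space k \<subseteq> ?T"
    unfolding bubble_space_def
  proof (rule span_minimal)
    show "subspace ?T"
    proof (rule subspaceI)
      show "0 \<in> ?T"
        by (auto intro!: exI[of _ "\<lambda>_ _. 0"] simp: bubble_coeff_zero polynomial_zero)
    next
      fix f g assume "f \<in> ?T" "g \<in> ?T"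
      then obtain A B where "\<forall>j a. a \<notin> bubble_index k j \<longrightarrow> A j a = 0"
          "\<forall>x j. f x $ j = polynomial (Suc k) (bubble_coeff A j) x"
          "\<forall>j a. a \<notin> bubble_index k j \<longrightarrow> B j a = 0"
          "\<forall>x j. g x $ j = polynomial (Suc k) (bubble_coeff B j) x"
        by auto
      then show "f + g \<in> ?T"
        by (auto intro!: exI[of _ "\<lambda>j a. A j a + B j a"] simp: bubble_coeff_add polynomial_add)
    next
      fix r f assume "f \<in> ?T"
      then obtain A where "\<forall>j a. a \<notin> bubble_index k j \<longrightarrow> A j a = 0"
          "\<forall>x j. f x $ j = polynomial (Suc k) (bubble_coeff A j) x"
        by auto
      then show "r *\<^sub>R f \<in> ?T"
        by (auto intro!: exI[of _ "\<lambda>j a. r * A j a"]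
            simp: bubble_coeff_scale polynomial_scale scaleR_fun_def)
    qed
  next
    show "{bubble i a | i a. a \<in> bubble_index k i} \<subseteq> ?T"
    proof clarify
      fix i :: 'd and a assume a: "a \<in> bubble_index k i"
      have "bubble i a x $ l =
          polynomial (Suc k) (bubble_coeff (\<lambda>j b. if j = i \<and> b = a then 1 else 0) l) x" for x l
      proof (cases "l = i")
        case True
        have "a \<in> exponent_box (Suc k)" using a by (auto simp: bubble_index_def exponent_box_def le_SucI)
        then show ?thesis
          using True by (simp add: bubble_coeff_single bubble_def polynomial_single)
      next
        case False
        have "a(i := a i - 1, l := Suc (a l)) \<in> exponent_box (Suc k)"
          using a by (auto simp: bubble_index_def exponent_box_def le_SucI le_diff_conv)
        then show ?thesis
          using False by (simp add: bubble_coeff_single bubble_def polynomial_single)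
      qed
      then show "\<exists>A. (\<forall>j a. a \<notin> bubble_index k j \<longrightarrow> A j a = 0) \<and>
                    (\<forall>x j. bubble i a x $ j = polynomial (Suc k) (bubble_coeff A j) x)"
        using a by (intro exI[of _ "\<lambda>j b. if j = i \<and> b = a then 1 else 0"]) auto
    qed
  qed
  then show ?thesis using assms that by blast
qed

lemma span_monomials_coeffs:
  fixes f :: "real ^ 'd::finite \<Rightarrow> real"
  assumes "f \<in> span (monomial ` I)" "I \<subseteq> exponent_box N"
  obtains c where "\<And>a. a \<notin> I \<Longrightarrow> c a = 0" "f = polynomial N c"
proof -
  let ?T = "{f :: real ^ 'd \<Rightarrow> real. \<exists>c. (\<forall>a. a \<notin> I \<longrightarrow> c a = 0) \<and> (\<forall>x. f x = polynomial N c x)}"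
  have "span (monomial ` I) \<subseteq> ?T"
  proof (rule span_minimal)
    show "subspace ?T"
    proof (rule subspaceI)
      show "0 \<in> ?T" by (auto intro!: exI[of _ "\<lambda>_. 0"] simp: polynomial_zero)
    next
      fix f g assume "f \<in> ?T" "g \<in> ?T"
      then obtain c d where "\<forall>a. a \<notin> I \<longrightarrow> c a = 0" "\<forall>x. f x = polynomial N c x"
          "\<forall>a. a \<notin> I \<longrightarrow> d a = 0" "\<forall>x. g x = polynomial N d x"
        by auto
      then show "f + g \<in> ?T"
        by (auto intro!: exI[of _ "\<lambda>a. c a + d a"] simp: polynomial_add)
    next
      fix r f assume "f \<in> ?T"
      then obtain c where "\<forall>a. a \<notin> I \<longrightarrow> c a = 0" "\<forall>x. f x = polynomial N c x"
        by auto
      then show "r *\<^sub>R f \<in> ?T"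
        by (auto intro!: exI[of _ "\<lambda>a. r * c a"] simp: polynomial_scale scaleR_fun_def)
    qed
    show "monomial ` I \<subseteq> ?T"
    proof clarify
      fix m assume "m \<in> I"
      then show "\<exists>c. (\<forall>a. a \<notin> I \<longrightarrow> c a = 0) \<and> (\<forall>x. monomial m x = polynomial N c x)"
        using assms(2)
        by (intro exI[of _ "\<lambda>a. if a = m then 1 else 0"]) (auto simp: polynomial_single subset_iff)
    qed
  qed
  then show ?thesis using assms that by blast
qed

definition RT_index :: "nat \<Rightarrow> 'd \<Rightarrow> ('d \<Rightarrow> nat) set"
  where "RT_index m i = {a. a i \<le> Suc m \<and> (\<forall>j. j \<noteq> i \<longrightarrow> a j \<le> m)}"

lemma Q_space_eq: "Q_space m = span (monomial ` exponent_box m)"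
  unfolding Q_space_def exponent_box_def monomial_def
  by (rule arg_cong[where f = span]) (auto simp: monomial_def fun_eq_iff)

lemma monomial_mult: "x $ i * monomial a x = monomial (a(i := Suc (a i))) (x :: real ^ 'd::finite)"
proof -
  have "(\<Prod>j\<in>-{i}. x $ j ^ (a(i := Suc (a i))) j) = (\<Prod>j\<in>-{i}. x $ j ^ a j)"
    by (intro prod.cong) auto
  then show ?thesis
    unfolding monomial_def by (subst (1 2) prod.remove[of _ i]) (auto simp: Compl_eq_Diff_UNIV)
qed

lemma RT_component_span:
  fixes q :: "real ^ 'd \<Rightarrow> real ^ 'd::finite"
  assumes "q \<in> RT_space m"
  shows "(\<lambda>x. q x $ i) \<in> span (monomial ` RT_index m i)"
proof -
  let ?V = "span (monomial ` RT_index m i)"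
  obtain f g where f: "f \<in> Q_space m" and g: "g \<in> Q_space m"
      and q: "(\<lambda>x. q x $ i) = f + (\<lambda>x. x $ i * g x)"
  proof -
    from assms have "(\<lambda>x. q x $ i) \<in> Q_space m + {\<lambda>x. x $ i * g x | g. g \<in> Q_space m}"
      unfolding RT_space_def by simp
    then show ?thesis using that by (elim set_plus_elim) auto
  qed
  have "Q_space m \<subseteq> ?V"
    unfolding Q_space_eq by (intro span_mono image_mono) (auto simp: exponent_box_def RT_index_def le_SucI)
  moreover have "(\<lambda>x. x $ i * g x) \<in> ?V"
  proof -
    let ?T = "{g. (\<lambda>x. x $ i * g x) \<in> ?V}"
    have "Q_space m \<subseteq> ?T"
      unfolding Q_space_eq
    proof (rule span_minimal)
      show "subspace ?T"
      proof (rule subspaceI)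
        show "0 \<in> ?T" using span_zero[of "monomial ` RT_index m i"] by (simp add: zero_fun_def)
      next
        fix f g assume "f \<in> ?T" "g \<in> ?T"
        then have "(\<lambda>x. x $ i * f x) + (\<lambda>x. x $ i * g x) \<in> ?V" by (auto intro: span_add)
        then show "f + g \<in> ?T" by (simp add: plus_fun_def algebra_simps)
      next
        fix r f assume "f \<in> ?T"
        then have "r *\<^sub>R (\<lambda>x. x $ i * f x) \<in> ?V" by (auto intro: span_scale)
        then show "r *\<^sub>R f \<in> ?T" by (simp add: scaleR_fun_def algebra_simps)
      qed
      show "monomial ` exponent_box m \<subseteq> ?T"
        by (auto simp: monomial_mult exponent_box_def RT_index_def intro!: span_base)
    qed
    then show ?thesis using g by auto
  qed
  ultimately show ?thesis
    unfolding q using f by (auto intro: span_add)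
qed


section \<open>Unisolvence in arbitrary dimension\<close>

text \<open>
  The maximum principle for the weighted Laplacian of a complete graph: at a vertex outside the
  boundary \<open>K\<close> where \<open>\<bar>D\<bar>\<close> is maximal, the products of \<open>D i\<close> with the terms of the sum are all
  nonnegative, and the one belonging to a boundary vertex is positive unless \<open>D i = 0\<close>.
\<close>

lemma diagonally_dominant_zero:
  fixes w D :: "'d::finite \<Rightarrow> real"
  assumes w: "\<And>j. w j > 0" and K: "K \<noteq> {}" and DK: "\<And>j. j \<in> K \<Longrightarrow> D j = 0"
    and eq: "\<And>i. i \<notin> K \<Longrightarrow> (\<Sum>j\<in>-{i}. w j * (D i - D j)) = 0"
  shows "D j = 0"
proof -
  obtain i where i: "\<And>j. \<bar>D j\<bar> \<le> \<bar>D i\<bar>"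
  proof -
    have "Max (range (\<lambda>j. \<bar>D j\<bar>)) \<in> range (\<lambda>j. \<bar>D j\<bar>)" by (intro Max_in) auto
    then obtain i where "Max (range (\<lambda>j. \<bar>D j\<bar>)) = \<bar>D i\<bar>" by (rule rangeE)
    then show ?thesis using that by (metis Max_ge finite_class.finite_UNIV finite_imageI rangeI)
  qed
  have "D i = 0"
  proof (rule ccontr)
    assume "D i \<noteq> 0"
    then have "i \<notin> K" using DK by auto
    obtain l where l: "l \<in> K" "l \<noteq> i" using K \<open>i \<notin> K\<close> by auto
    have "D i * (D i - D j) \<ge> 0" for j
    proof -
      have "D i * D j \<le> \<bar>D i\<bar> * \<bar>D j\<bar>" by (metis abs_ge_self abs_mult)
      also have "\<dots> \<le> \<bar>D i\<bar> * \<bar>D i\<bar>" by (intro mult_left_mono i) auto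
      finally show ?thesis by (simp add: algebra_simps)
    qed
    then have nonneg: "w j * (D i * (D i - D j)) \<ge> 0" for j
      using w[of j] by simp
    have "w l * (D i * (D i - D l)) > 0"
      using w[of l] DK[OF l(1)] \<open>D i \<noteq> 0\<close> by (simp add: zero_less_mult_iff neq_iff disj_commute)
    then have "0 < (\<Sum>j\<in>-{i}. w j * (D i * (D i - D j)))"
      using nonneg l by (intro sum_pos2[of _ l]) auto
    also have "\<dots> = D i * (\<Sum>j\<in>-{i}. w j * (D i - D j))"
      by (simp add: sum_distrib_left mult_ac)
    finally show False using eq[OF \<open>i \<notin> K\<close>] by simp
  qed
  then show ?thesis using i[of j] by simp
qed

text \<open>
  Indexing a bubble of direction \<open>j\<close> by its exponent lowered by \<open>e\<^sub>j\<close> decouples the coefficients: the one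
  at \<open>b + e\<^sub>i\<close> involves only bubbles with the same index \<open>b\<close>, and is their weighted Laplacian.
\<close>

lemma bubble_coeff_shift:
  "bubble_coeff A i (b(i := Suc (b i))) =
     (\<Sum>j\<in>-{i}. (real (b j) + 1) * (A i (b(i := Suc (b i))) - A j (b(j := Suc (b j)))))"
  unfolding bubble_coeff_def by (intro sum.cong) auto

lemma bubble_coeff_support:
  assumes A: "\<And>j a. a \<notin> bubble_index k j \<Longrightarrow> A j a = 0" and "bubble_coeff A i a \<noteq> 0"
  shows "a i \<le> Suc k \<and> (\<forall>j. j \<noteq> i \<longrightarrow> a j \<le> k)"
proof -
  from assms(2) obtain j where "j \<noteq> i"
      and "A i a \<noteq> 0 \<or> (a i \<noteq> 0 \<and> A j (a(i := a i - 1, j := Suc (a j))) \<noteq> 0)"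
    unfolding bubble_coeff_def
    by (elim sum.not_neutral_contains_not_neutral) (auto split: if_splits)
  then consider "a \<in> bubble_index k i" | "a(i := a i - 1, j := Suc (a j)) \<in> bubble_index k j"
    using A by blast
  then show ?thesis
  proof cases
    case 1
    then show ?thesis by (auto simp: bubble_index_def le_SucI)
  next
    case 2
    then have le: "(a(i := a i - 1, j := Suc (a j))) l \<le> k" for l
      unfolding bubble_index_def by blast
    have "a i \<le> Suc k"
      using le[of i] \<open>j \<noteq> i\<close> by simp
    moreover have "a l \<le> k" if "l \<noteq> i" for l
      using le[of l] that by (cases "l = j") simp_all
    ultimately show ?thesis by blast
  qed
qed

text \<open>
  The bubbles in different directions interact, since each has entries in all components. The
  coefficients \<open>D\<close> separate this interaction into small linear systems, one for each exponent \<open>b\<close>; the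
  right-hand sides couple \<open>b\<close> only to exponents with more entries equal to \<open>k\<close>.
\<close>

theorem enhanced_RT_unisolvent:
  fixes q :: "real ^ 'd \<Rightarrow> real ^ 'd::finite"
  assumes k: "k \<ge> 1" and q: "q \<in> RT_space (k - 1) + bubble_space k"
    and card: "card S = Suc k" and grid: "\<And>x. \<forall>j. x $ j \<in> S \<Longrightarrow> q x = 0"
  shows "q = (\<lambda>x. 0)"
proof -
  obtain r s where r: "r \<in> RT_space (k - 1)" and s: "s \<in> bubble_space k" and qrs: "q = r + s"
    using q by (auto elim: set_plus_elim)
  obtain A where A: "\<And>j a. a \<notin> bubble_index k j \<Longrightarrow> A j a = 0"
      and sA: "\<And>x j. s x $ j = polynomial (Suc k) (bubble_coeff A j) x"
    using bubble_space_coeffs[OF s] by metis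
  have "\<exists>c. (\<forall>a. a \<notin> RT_index (k - 1) i \<longrightarrow> c a = 0) \<and>
      (\<lambda>x. r x $ i) = polynomial (Suc k) c" for i
  proof -
    have "a j \<le> Suc k" if "a \<in> RT_index (k - 1) i" for a j
      using that by (cases "j = i") (fastforce simp: RT_index_def)+
    then have "RT_index (k - 1) i \<subseteq> exponent_box (Suc k)"
      unfolding exponent_box_def by blast
    from span_monomials_coeffs[OF RT_component_span[OF r] this] show ?thesis by metis
  qed
  then obtain c where c: "\<And>i a. a \<notin> RT_index (k - 1) i \<Longrightarrow> c i a = 0"
      and rc: "\<And>i x. r x $ i = polynomial (Suc k) (c i) x"
    by metis
  define e where "e i a = c i a + bubble_coeff A i a" for i a
  have qe: "q x $ i = polynomial (Suc k) (e i) x" for x i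
    unfolding e_def by (simp add: qrs polynomial_add rc sA)
  have line: "e i (a(i := n)) = 0" if "e i (a(i := Suc k)) = 0" for i a n
  proof (rule grid_line_coeffs_zero[where c = "e i", OF card _ _ that])
    fix a assume "e i a \<noteq> 0"
    then consider "c i a \<noteq> 0" | "bubble_coeff A i a \<noteq> 0" unfolding e_def by fastforce
    then show "a i \<le> Suc k \<and> (\<forall>j. j \<noteq> i \<longrightarrow> a j \<le> k)"
    proof cases
      case 1
      then have "a \<in> RT_index (k - 1) i" using c by blast
      then show ?thesis using k by (auto simp: RT_index_def intro: le_trans)
    next
      case 2
      then show ?thesis using A by (rule bubble_coeff_support[rotated])
    qed
  next
    fix x :: "real ^ 'd" assume "\<forall>j. x $ j \<in> S"
    then show "polynomial (Suc k) (e i) x = 0"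
      using grid by (simp flip: qe)
  qed
  define D where "D b j = A j (b(j := Suc (b j)))" for b j
  have shift: "e i (b(i := Suc (b i))) =
      c i (b(i := Suc (b i))) + (\<Sum>j\<in>-{i}. (real (b j) + 1) * (D b i - D b j))" for i b
    by (simp add: e_def bubble_coeff_shift D_def)
  \<comment> \<open>Exponents with \<open>i\<close>-th entry \<open>k + 1\<close> lie beyond the Raviart--Thomas part, so only the Laplacian
    at \<open>b\<close> with \<open>i\<close>-th entry \<open>k\<close> is left.\<close>
  have lead: "e i (b(i := Suc k)) = 0" if "\<And>j. D (b(i := k)) j = 0" for i b
    using shift[of i "b(i := k)"] k by (simp add: that c RT_index_def)
  have D: "D b j = 0" for b j
  \<comment> \<open>Raising one more entry of \<open>b\<close> to \<open>k\<close> makes the measure smaller.\<close>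
  proof (induction "card {l. b l \<noteq> k}" arbitrary: b j rule: less_induct)
    case less
    let ?K = "{l. b l = k}"
    show ?case
    proof (cases "?K = {}")
      case True
      then show ?thesis
        unfolding D_def by (intro A) (auto simp: bubble_index_def)
    next
      case False
      show ?thesis
      proof (rule diagonally_dominant_zero[OF _ False])
        show "D b j = 0" if "j \<in> ?K" for j
          unfolding D_def using that by (intro A) (auto simp: bubble_index_def intro!: exI[of _ j])
      next
        fix i assume i: "i \<notin> ?K"
        have "card {l. (b(i := k)) l \<noteq> k} < card {l. b l \<noteq> k}"
          using i by (intro psubset_card_mono) auto
        then have "D (b(i := k)) j = 0" for j
          by (rule less)
        then have "e i (b(i := Suc (b i))) = 0"
          by (rule line[OF lead])
        moreover obtain l where "b l = k" "l \<noteq> i"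
          using False i by auto
        \<comment> \<open>Transversal degrees in the Raviart--Thomas part are at most \<open>k - 1\<close>.\<close>
        then have "c i (b(i := Suc (b i))) = 0"
          using k by (intro c) (auto simp: RT_index_def intro!: exI[of _ l])
        ultimately show "(\<Sum>j\<in>-{i}. (real (b j) + 1) * (D b i - D b j)) = 0"
          by (simp add: shift)
      qed auto
    qed
  qed
  have "e i a = 0" for i a
    using line[OF lead[OF D], of i a "a i"] by simp
  then have "q x $ i = 0" for x i
    by (simp add: qe polynomial_def)
  then show ?thesis by (simp add: fun_eq_iff vec_eq_iff)
qed


section \<open>Dimensions two and three\<close>

lemma span_subset_bubble_space:
  "\<forall>f\<in>F. \<exists>i a. f = bubble i a \<and> a \<in> bubble_index k i \<Longrightarrow> span F \<subseteq> bubble_space k"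
  unfolding bubble_space_def by (intro span_mono) auto

lemma set_plus_subset_bubble_space:
  "F \<subseteq> bubble_space k \<Longrightarrow> G \<subseteq> bubble_space k \<Longrightarrow> F + G \<subseteq> bubble_space k"
  unfolding bubble_space_def by (auto elim!: set_plus_elim intro!: span_add)

lemma Compl_2: "- {1 :: 2} = {2}" "- {2 :: 2} = {1}"
  using UNIV_2 by auto

lemma Compl_3: "- {1 :: 3} = {2, 3}" "- {2 :: 3} = {1, 3}" "- {3 :: 3} = {1, 2}"
  using UNIV_3 by auto

lemma exists_3: "(\<exists>j :: 3. P j) \<longleftrightarrow> P 1 \<or> P 2 \<or> P 3"
proof
  assume "\<exists>j :: 3. P j"
  then obtain j where "P j" ..
  then show "P 1 \<or> P 2 \<or> P 3" using exhaust_3[of j] by auto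
qed auto

lemma enhanced_RT2_subset: "enhanced_RT2 k \<subseteq> RT_space (k - 1) + bubble_space k"
proof -
  let ?a = "\<lambda>m n. \<lambda>j :: 2. if j = 1 then m else n :: nat"
  have "bubble2_1 k \<subseteq> bubble_space k"
    unfolding bubble2_1_def
  proof (rule span_subset_bubble_space, clarify)
    fix a1 a2 assume "a1 \<le> k" "k \<le> k"
    then show "\<exists>i a. (\<lambda>x :: real ^ 2. vector [real (k + 1) * x$1 ^ a1 * x$2 ^ k,
       - real a1 * x$1 ^ (a1 - 1) * x$2 ^ (k + 1)]) = bubble i a \<and> a \<in> bubble_index k i"
      by (intro exI[of _ 1] exI[of _ "?a a1 k"])
        (auto simp: bubble_def monomial_def bubble_index_def UNIV_2 Compl_2 fun_eq_iff vec_eq_iff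
          forall_2 algebra_simps intro!: exI[of _ 2])
  qed
  moreover have "bubble2_2 k \<subseteq> bubble_space k"
    unfolding bubble2_2_def
  proof (rule span_subset_bubble_space, clarify)
    fix b1 b2 assume "b2 \<le> k"
    then show "\<exists>i a. (\<lambda>x :: real ^ 2. vector [- real b2 * x$1 ^ (k + 1) * x$2 ^ (b2 - 1),
       real (k + 1) * x$1 ^ k * x$2 ^ b2]) = bubble i a \<and> a \<in> bubble_index k i"
      by (intro exI[of _ 2] exI[of _ "?a k b2"])
        (auto simp: bubble_def monomial_def bubble_index_def UNIV_2 Compl_2 fun_eq_iff vec_eq_iff
          forall_2 algebra_simps intro!: exI[of _ 1])
  qed
  ultimately have "bubble2_1 k + bubble2_2 k \<subseteq> bubble_space k"
    by (rule set_plus_subset_bubble_space)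
  then show ?thesis
    unfolding enhanced_RT2_def by (intro set_plus_mono2) auto
qed

lemma enhanced_RT3_subset: "enhanced_RT3 k \<subseteq> RT_space (k - 1) + bubble_space k"
proof -
  let ?a = "\<lambda>l m n. \<lambda>j :: 3. if j = 1 then l else if j = 2 then m else n :: nat"
  have "bubble3_1 k \<subseteq> bubble_space k"
    unfolding bubble3_1_def
  proof (rule span_subset_bubble_space, intro ballI, elim CollectE exE conjE)
    fix f :: "real ^ 3 \<Rightarrow> real ^ 3" and a1 a2 a3
    assume f: "f = (\<lambda>x :: real ^ 3. vector
        [real (a2 + a3 + 2) * x$1 ^ a1 * x$2 ^ a2 * x$3 ^ a3,
         - real a1 * x$1 ^ (a1 - 1) * x$2 ^ (a2 + 1) * x$3 ^ a3,
         - real a1 * x$1 ^ (a1 - 1) * x$2 ^ a2 * x$3 ^ (a3 + 1)])"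
      and le: "a1 \<le> k" "a2 \<le> k" "a3 \<le> k" "a2 = k \<or> a3 = k"
    have "?a a1 a2 a3 \<in> bubble_index k 1"
      using le by (auto simp: bubble_index_def exists_3)
    moreover have "f x $ j = bubble 1 (?a a1 a2 a3) x $ j" for x and j :: 3
      unfolding f bubble_def monomial_def UNIV_3 Compl_3
      using exhaust_3[of j] by (elim disjE) (simp_all add: algebra_simps)
    then have "f = bubble 1 (?a a1 a2 a3)"
      by (simp add: fun_eq_iff vec_eq_iff)
    ultimately show "\<exists>i a. f = bubble i a \<and> a \<in> bubble_index k i" by blast
  qed
  moreover have "bubble3_2 k \<subseteq> bubble_space k"
    unfolding bubble3_2_def
  proof (rule span_subset_bubble_space, intro ballI, elim CollectE exE conjE)
    fix f :: "real ^ 3 \<Rightarrow> real ^ 3" and b1 b2 b3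
    assume f: "f = (\<lambda>x :: real ^ 3. vector
        [- real b2 * x$1 ^ (b1 + 1) * x$2 ^ (b2 - 1) * x$3 ^ b3,
         real (b1 + b3 + 2) * x$1 ^ b1 * x$2 ^ b2 * x$3 ^ b3,
         - real b2 * x$1 ^ b1 * x$2 ^ (b2 - 1) * x$3 ^ (b3 + 1)])"
      and le: "b1 \<le> k" "b2 \<le> k" "b3 \<le> k" "b1 = k \<or> b3 = k"
    have "?a b1 b2 b3 \<in> bubble_index k 2"
      using le by (auto simp: bubble_index_def exists_3)
    moreover have "f x $ j = bubble 2 (?a b1 b2 b3) x $ j" for x and j :: 3
      unfolding f bubble_def monomial_def UNIV_3 Compl_3
      using exhaust_3[of j] by (elim disjE) (simp_all add: algebra_simps)
    then have "f = bubble 2 (?a b1 b2 b3)"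
      by (simp add: fun_eq_iff vec_eq_iff)
    ultimately show "\<exists>i a. f = bubble i a \<and> a \<in> bubble_index k i" by blast
  qed
  moreover have "bubble3_3 k \<subseteq> bubble_space k"
    unfolding bubble3_3_def
  proof (rule span_subset_bubble_space, intro ballI, elim CollectE exE conjE)
    fix f :: "real ^ 3 \<Rightarrow> real ^ 3" and c1 c2 c3
    assume f: "f = (\<lambda>x :: real ^ 3. vector
        [- real c3 * x$1 ^ (c1 + 1) * x$2 ^ c2 * x$3 ^ (c3 - 1),
         - real c3 * x$1 ^ c1 * x$2 ^ (c2 + 1) * x$3 ^ (c3 - 1),
         real (c1 + c2 + 2) * x$1 ^ c1 * x$2 ^ c2 * x$3 ^ c3])"
      and le: "c1 \<le> k" "c2 \<le> k" "c3 \<le> k" "c1 = k \<or> c2 = k"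
    have "?a c1 c2 c3 \<in> bubble_index k 3"
      using le by (auto simp: bubble_index_def exists_3)
    moreover have "f x $ j = bubble 3 (?a c1 c2 c3) x $ j" for x and j :: 3
      unfolding f bubble_def monomial_def UNIV_3 Compl_3
      using exhaust_3[of j] by (elim disjE) (simp_all add: algebra_simps)
    then have "f = bubble 3 (?a c1 c2 c3)"
      by (simp add: fun_eq_iff vec_eq_iff)
    ultimately show "\<exists>i a. f = bubble i a \<and> a \<in> bubble_index k i" by blast
  qed
  ultimately have "bubble3_1 k + bubble3_2 k + bubble3_3 k \<subseteq> bubble_space k"
    by (intro set_plus_subset_bubble_space)
  then show ?thesis
    unfolding enhanced_RT3_def by (intro set_plus_mono2) auto
qed

lemma gl_point_unisolvent:
  fixes q :: "real ^ 'd \<Rightarrow> real ^ 'd::finite"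
  assumes k: "k \<ge> 1" and q: "q \<in> RT_space (k - 1) + bubble_space k"
    and grid: "\<forall>i :: 'd \<Rightarrow> nat. (\<forall>j. i j \<le> k) \<longrightarrow> q (gl_point k i) = 0"
  shows "q = (\<lambda>x. 0)"
proof (rule enhanced_RT_unisolvent[OF k q gl_node_range[OF k]])
  fix x :: "real ^ 'd" assume "\<forall>j. x $ j \<in> gl_node k ` {..k}"
  then have "\<forall>j. \<exists>n. n \<le> k \<and> x $ j = gl_node k n" by auto
  then obtain i where "\<forall>j. i j \<le> k \<and> x $ j = gl_node k (i j)" by metis
  then show "q x = 0"
    using grid by (metis (no_types, lifting) gl_point_def vec_lambda_unique)
qed

theorem lemma2p3:
  fixes k :: nat
  assumes "k \<ge> 1"
  shows "(\<forall>q \<in> enhanced_RT2 k.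
           (\<forall>i :: 2 \<Rightarrow> nat. (\<forall>j. i j \<le> k) \<longrightarrow> q (gl_point k i) = 0) \<longrightarrow> q = (\<lambda>x. 0)) \<and>
         (\<forall>q \<in> enhanced_RT3 k.
           (\<forall>i :: 3 \<Rightarrow> nat. (\<forall>j. i j \<le> k) \<longrightarrow> q (gl_point k i) = 0) \<longrightarrow> q = (\<lambda>x. 0))"
proof (intro conjI ballI impI)
  fix q assume "q \<in> enhanced_RT2 k"
  then have "q \<in> RT_space (k - 1) + bubble_space k" by (rule subsetD[OF enhanced_RT2_subset])
  moreover assume "\<forall>i :: 2 \<Rightarrow> nat. (\<forall>j. i j \<le> k) \<longrightarrow> q (gl_point k i) = 0"
  ultimately show "q = (\<lambda>x. 0)" by (rule gl_point_unisolvent[OF assms])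
next
  fix q assume "q \<in> enhanced_RT3 k"
  then have "q \<in> RT_space (k - 1) + bubble_space k" by (rule subsetD[OF enhanced_RT3_subset])
  moreover assume "\<forall>i :: 3 \<Rightarrow> nat. (\<forall>j. i j \<le> k) \<longrightarrow> q (gl_point k i) = 0"
  ultimately show "q = (\<lambda>x. 0)" by (rule gl_point_unisolvent[OF assms])
qed

end
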